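(* The rule ($\rho9$): from $(\phi\rightsquigarrow p)\wedge(p\rightsquigarrow\psi)\wedge(p\rightsquigarrow p)\to\chi$ infer $(\phi\rightsquigarrow\psi)\to\chi$ (where $p$ is a propositional variable not occurring in $\phi,\psi,\chi$) is admissible in $\mathsf{MS^2IC}$: whenever the premise is a theorem of $\mathsf{MS^2IC}$ with $p$ not occurring in $\phi,\psi,\chi$, so is $(\phi\rightsquigarrow\psi)\to\chi$.
   Context: Language: propositional variables, $\top,\bot$, $\neg,\wedge,\vee,\to,\leftrightarrow$, a binary connective $\rightsquigarrow$ and a unary modality $\Box$; $\Diamond\phi:=\neg\Box\neg\phi$, $[\forall]\phi:=\top\rightsquigarrow\phi$. $\mathsf{MS^2IC}$: theorems are the least set containing all instances of classical tautologies and of (A1) $(\bot\rightsquigarrow\phi)\wedge(\phi\rightsquigarrow\top)$; (A2) $((\phi\vee\psi)\rightsquigarrow\chi)\leftrightarrow((\phi\rightsquigarrow\chi)\wedge(\psi\rightsquigarrow\chi))$; (A3) $(\phi\rightsquigarrow(\psi\wedge\chi))\leftrightarrow((\phi\rightsquigarrow\psi)\wedge(\phi\rightsquigarrow\chi))$; (A4) $(\phi\rightsquigarrow\psi)\to(\phi\to\psi)$; (A5) $(\phi\rightsquigarrow\psi)\leftrightarrow(\neg\psi\rightsquigarrow\neg\phi)$; (A8) $[\forall]\phi\to[\forall][\forall]\phi$; (A9) $\neg[\forall]\phi\to[\forall]\neg[\forall]\phi$; (A10) $(\phi\rightsquigarrow\psi)\leftrightarrow[\forall](\phi\rightsquigarrow\psi)$;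 (A11) $[\forall]\phi\to(\neg[\forall]\phi\rightsquigarrow\bot)$; (K) $\Box(\phi\to\psi)\to(\Box\phi\to\Box\psi)$; (Add) $(\phi\rightsquigarrow\psi)\to(\Box\phi\rightsquigarrow\Box\psi)$; closed under modus ponens, from $\phi$ infer $[\forall]\phi$, from $\phi$ infer $\Box\phi$. *)

theory Defs
  imports Main
begin

datatype fm =
    Var nat
  | Top  ("\<^bold>\<top>")
  | Bot  ("\<^bold>\<bottom>")
  | Neg fm  ("\<^bold>\<not> _" [75] 75)
  | And fm fm  (infixr "\<^bold>\<and>" 65)
  | Or fm fm  (infixr "\<^bold>\<or>" 60)
  | Imp fm fm  (infixr "\<^bold>\<longrightarrow>" 55)
  | Iff fm fm  (infixr "\<^bold>\<longleftrightarrow>" 52)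
  | Strict fm fm  (infix "\<^bold>\<leadsto>" 70)
  | Box fm  ("\<^bold>\<box> _" [75] 75)

abbreviation All :: "fm \<Rightarrow> fm"  ("\<^bold>[\<^bold>\<forall>\<^bold>] _" [75] 75) where
  "\<^bold>[\<^bold>\<forall>\<^bold>] \<phi> \<equiv> \<^bold>\<top> \<^bold>\<leadsto> \<phi>"

fun vars :: "fm \<Rightarrow> nat set" where
  "vars (Var n) = {n}"
| "vars \<^bold>\<top> = {}"
| "vars \<^bold>\<bottom> = {}"
| "vars (\<^bold>\<not> \<phi>) = vars \<phi>"
| "vars (\<phi> \<^bold>\<and> \<psi>) = vars \<phi> \<union> vars \<psi>"
| "vars (\<phi> \<^bold>\<or> \<psi>) = vars \<phi> \<union> vars \<psi>"
| "vars (\<phi> \<^bold>\<longrightarrow> \<psi>) = vars \<phi> \<union> vars \<psi>"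
| "vars (\<phi> \<^bold>\<longleftrightarrow> \<psi>) = vars \<phi> \<union> vars \<psi>"
| "vars (\<phi> \<^bold>\<leadsto> \<psi>) = vars \<phi> \<union> vars \<psi>"
| "vars (\<^bold>\<box> \<phi>) = vars \<phi>"

(* Formulas of the classical language (no \<leadsto>, no \<box>), used only to say
   what an instance of a classical tautology is. *)
datatype cfm =
    CVar nat
  | CTop
  | CBot
  | CNeg cfm
  | CAnd cfm cfm
  | COr cfm cfm
  | CImp cfm cfm
  | CIff cfm cfm

primrec ceval :: "(nat \<Rightarrow> bool) \<Rightarrow> cfm \<Rightarrow> bool" where
  "ceval v (CVar n) \<longleftrightarrow> v n"
| "ceval v CTop \<longleftrightarrow> True"
| "ceval v CBot \<longleftrightarrow> False"
| "ceval v (CNeg a) \<longleftrightarrow> \<not> ceval v a"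
| "ceval v (CAnd a b) \<longleftrightarrow> ceval v a \<and> ceval v b"
| "ceval v (COr a b) \<longleftrightarrow> ceval v a \<or> ceval v b"
| "ceval v (CImp a b) \<longleftrightarrow> (ceval v a \<longrightarrow> ceval v b)"
| "ceval v (CIff a b) \<longleftrightarrow> (ceval v a \<longleftrightarrow> ceval v b)"

definition tautology :: "cfm \<Rightarrow> bool" where
  "tautology a \<longleftrightarrow> (\<forall>v. ceval v a)"

primrec inst :: "(nat \<Rightarrow> fm) \<Rightarrow> cfm \<Rightarrow> fm" where
  "inst s (CVar n) = s n"
| "inst s CTop = \<^bold>\<top>"
| "inst s CBot = \<^bold>\<bottom>"
| "inst s (CNeg a) = \<^bold>\<not> inst s a"
| "inst s (CAnd a b) = inst s a \<^bold>\<and> inst s b"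
| "inst s (COr a b) = inst s a \<^bold>\<or> inst s b"
| "inst s (CImp a b) = inst s a \<^bold>\<longrightarrow> inst s b"
| "inst s (CIff a b) = inst s a \<^bold>\<longleftrightarrow> inst s b"

inductive_set MS2IC :: "fm set" where
  Taut: "tautology a \<Longrightarrow> inst s a \<in> MS2IC"
| A1: "(\<^bold>\<bottom> \<^bold>\<leadsto> \<phi>) \<^bold>\<and> (\<phi> \<^bold>\<leadsto> \<^bold>\<top>) \<in> MS2IC"
| A2: "((\<phi> \<^bold>\<or> \<psi>) \<^bold>\<leadsto> \<chi>) \<^bold>\<longleftrightarrow> ((\<phi> \<^bold>\<leadsto> \<chi>) \<^bold>\<and> (\<psi> \<^bold>\<leadsto> \<chi>)) \<in> MS2IC"
| A3: "(\<phi> \<^bold>\<leadsto> (\<psi> \<^bold>\<and> \<chi>)) \<^bold>\<longleftrightarrow> ((\<phi> \<^bold>\<leadsto> \<psi>) \<^bold>\<and> (\<phi> \<^bold>\<leadsto> \<chi>)) \<in> MS2IC"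
| A4: "(\<phi> \<^bold>\<leadsto> \<psi>) \<^bold>\<longrightarrow> (\<phi> \<^bold>\<longrightarrow> \<psi>) \<in> MS2IC"
| A5: "(\<phi> \<^bold>\<leadsto> \<psi>) \<^bold>\<longleftrightarrow> ((\<^bold>\<not> \<psi>) \<^bold>\<leadsto> (\<^bold>\<not> \<phi>)) \<in> MS2IC"
| A8: "\<^bold>[\<^bold>\<forall>\<^bold>] \<phi> \<^bold>\<longrightarrow> \<^bold>[\<^bold>\<forall>\<^bold>] (\<^bold>[\<^bold>\<forall>\<^bold>] \<phi>) \<in> MS2IC"
| A9: "\<^bold>\<not> (\<^bold>[\<^bold>\<forall>\<^bold>] \<phi>) \<^bold>\<longrightarrow> \<^bold>[\<^bold>\<forall>\<^bold>] (\<^bold>\<not> (\<^bold>[\<^bold>\<forall>\<^bold>] \<phi>)) \<in> MS2IC"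
| A10: "(\<phi> \<^bold>\<leadsto> \<psi>) \<^bold>\<longleftrightarrow> \<^bold>[\<^bold>\<forall>\<^bold>] (\<phi> \<^bold>\<leadsto> \<psi>) \<in> MS2IC"
| A11: "\<^bold>[\<^bold>\<forall>\<^bold>] \<phi> \<^bold>\<longrightarrow> ((\<^bold>\<not> (\<^bold>[\<^bold>\<forall>\<^bold>] \<phi>)) \<^bold>\<leadsto> \<^bold>\<bottom>) \<in> MS2IC"
| K: "\<^bold>\<box> (\<phi> \<^bold>\<longrightarrow> \<psi>) \<^bold>\<longrightarrow> (\<^bold>\<box> \<phi> \<^bold>\<longrightarrow> \<^bold>\<box> \<psi>) \<in> MS2IC"
| Add: "(\<phi> \<^bold>\<leadsto> \<psi>) \<^bold>\<longrightarrow> ((\<^bold>\<box> \<phi>) \<^bold>\<leadsto> (\<^bold>\<box> \<psi>)) \<in> MS2IC"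
| MP: "\<lbrakk>\<phi> \<in> MS2IC; \<phi> \<^bold>\<longrightarrow> \<psi> \<in> MS2IC\<rbrakk> \<Longrightarrow> \<psi> \<in> MS2IC"
| Nec_All: "\<phi> \<in> MS2IC \<Longrightarrow> \<^bold>[\<^bold>\<forall>\<^bold>] \<phi> \<in> MS2IC"
| Nec_Box: "\<phi> \<in> MS2IC \<Longrightarrow> \<^bold>\<box> \<phi> \<in> MS2IC"

end

theory Submission
  imports Defs
begin

text \<open>
  The axioms do not make \<open>\<leadsto>\<close> respect provable equivalence, so it cannot be read as a relation
  between sets of worlds, and the argument treats it syntactically. Take a maximal consistent set
  containing \<open>\<phi> \<leadsto> \<psi>\<close> but not \<open>\<chi>\<close>, and all maximal consistent sets with the same \<open>\<leadsto>\<close>-formulas;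
  these form a Kripke model for \<open>\<box>\<close>. Make the fresh variable \<open>p\<close> true exactly where \<open>\<phi>\<close> is, and
  reinterpret \<open>\<alpha> \<leadsto> \<beta>\<close> as: \<open>\<alpha> \<rightarrow> \<beta>\<close> is true at all worlds, and none of the pairs without \<open>p\<close> to which
  (A2), (A3) and (A5) reduce \<open>(\<alpha>, \<beta>)\<close> was rejected originally. Nothing changes for formulas without
  \<open>p\<close>, all theorems are true, and \<open>\<phi> \<leadsto> p\<close>, \<open>p \<leadsto> \<psi>\<close>, \<open>p \<leadsto> p\<close> hold.
\<close>

section \<open>Maximal consistent sets\<close>

lemma tautology_instances:
  shows MS2IC_Top: "\<^bold>\<top> \<in> MS2IC"
    and MS2IC_not_Bot: "\<^bold>\<not> \<^bold>\<bottom> \<in> MS2IC"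
    and MS2IC_Imp_refl: "a \<^bold>\<longrightarrow> a \<in> MS2IC"
    and MS2IC_Imp_const: "a \<^bold>\<longrightarrow> b \<^bold>\<longrightarrow> a \<in> MS2IC"
    and MS2IC_Imp_distrib: "(a \<^bold>\<longrightarrow> b \<^bold>\<longrightarrow> c) \<^bold>\<longrightarrow> (a \<^bold>\<longrightarrow> b) \<^bold>\<longrightarrow> a \<^bold>\<longrightarrow> c \<in> MS2IC"
    and MS2IC_Neg_Imp: "(\<^bold>\<not> a) \<^bold>\<longrightarrow> a \<^bold>\<longrightarrow> b \<in> MS2IC"
    and MS2IC_Imp_Bot: "(a \<^bold>\<longrightarrow> \<^bold>\<bottom>) \<^bold>\<longrightarrow> (\<^bold>\<not> a) \<in> MS2IC"
    and MS2IC_classical: "((\<^bold>\<not> a) \<^bold>\<longrightarrow> \<^bold>\<bottom>) \<^bold>\<longrightarrow> a \<in> MS2IC"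
    and MS2IC_And1: "(a \<^bold>\<and> b) \<^bold>\<longrightarrow> a \<in> MS2IC"
    and MS2IC_And2: "(a \<^bold>\<and> b) \<^bold>\<longrightarrow> b \<in> MS2IC"
    and MS2IC_AndI: "a \<^bold>\<longrightarrow> b \<^bold>\<longrightarrow> (a \<^bold>\<and> b) \<in> MS2IC"
    and MS2IC_Or1: "a \<^bold>\<longrightarrow> (a \<^bold>\<or> b) \<in> MS2IC"
    and MS2IC_Or2: "b \<^bold>\<longrightarrow> (a \<^bold>\<or> b) \<in> MS2IC"
    and MS2IC_OrE: "(a \<^bold>\<or> b) \<^bold>\<longrightarrow> (\<^bold>\<not> a) \<^bold>\<longrightarrow> b \<in> MS2IC"
    and MS2IC_Iff1: "(a \<^bold>\<longleftrightarrow> b) \<^bold>\<longrightarrow> a \<^bold>\<longrightarrow> b \<in> MS2IC"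
    and MS2IC_Iff2: "(a \<^bold>\<longleftrightarrow> b) \<^bold>\<longrightarrow> b \<^bold>\<longrightarrow> a \<in> MS2IC"
    and MS2IC_IffI: "(a \<^bold>\<longrightarrow> b) \<^bold>\<longrightarrow> (b \<^bold>\<longrightarrow> a) \<^bold>\<longrightarrow> (a \<^bold>\<longleftrightarrow> b) \<in> MS2IC"
proof -
  \<comment> \<open>\<open>?s\<close> sends the classical variables 0, 1, 2 to \<open>a\<close>,
    \<open>b\<close>, \<open>c\<close>; each claim is then the image under \<open>inst ?s\<close> of
    an explicit tautology in \<open>?a\<close>, \<open>?b\<close>, \<open>?c\<close>.\<close>
  let ?s = "\<lambda>n. if n = 0 then a else if n = (1::nat) then b else c"
  let ?a = "CVar 0" and ?b = "CVar 1" and ?c = "CVar 2"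
  note T = Taut[where s = ?s, unfolded tautology_def]
  show "\<^bold>\<top> \<in> MS2IC" using T[of CTop] by simp
  show "\<^bold>\<not> \<^bold>\<bottom> \<in> MS2IC" using T[of "CNeg CBot"] by simp
  show "a \<^bold>\<longrightarrow> a \<in> MS2IC" using T[of "CImp ?a ?a"] by simp
  show "a \<^bold>\<longrightarrow> b \<^bold>\<longrightarrow> a \<in> MS2IC" using T[of "CImp ?a (CImp ?b ?a)"] by simp
  show "(a \<^bold>\<longrightarrow> b \<^bold>\<longrightarrow> c) \<^bold>\<longrightarrow> (a \<^bold>\<longrightarrow> b) \<^bold>\<longrightarrow> a \<^bold>\<longrightarrow> c \<in> MS2IC"
    using T[of "CImp (CImp ?a (CImp ?b ?c)) (CImp (CImp ?a ?b) (CImp ?a ?c))"] by simp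
  show "(\<^bold>\<not> a) \<^bold>\<longrightarrow> a \<^bold>\<longrightarrow> b \<in> MS2IC" using T[of "CImp (CNeg ?a) (CImp ?a ?b)"] by simp
  show "(a \<^bold>\<longrightarrow> \<^bold>\<bottom>) \<^bold>\<longrightarrow> (\<^bold>\<not> a) \<in> MS2IC" using T[of "CImp (CImp ?a CBot) (CNeg ?a)"] by simp
  show "((\<^bold>\<not> a) \<^bold>\<longrightarrow> \<^bold>\<bottom>) \<^bold>\<longrightarrow> a \<in> MS2IC" using T[of "CImp (CImp (CNeg ?a) CBot) ?a"] by simp
  show "(a \<^bold>\<and> b) \<^bold>\<longrightarrow> a \<in> MS2IC" using T[of "CImp (CAnd ?a ?b) ?a"] by simp
  show "(a \<^bold>\<and> b) \<^bold>\<longrightarrow> b \<in> MS2IC" using T[of "CImp (CAnd ?a ?b) ?b"] by simp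
  show "a \<^bold>\<longrightarrow> b \<^bold>\<longrightarrow> (a \<^bold>\<and> b) \<in> MS2IC" using T[of "CImp ?a (CImp ?b (CAnd ?a ?b))"] by simp
  show "a \<^bold>\<longrightarrow> (a \<^bold>\<or> b) \<in> MS2IC" using T[of "CImp ?a (COr ?a ?b)"] by simp
  show "b \<^bold>\<longrightarrow> (a \<^bold>\<or> b) \<in> MS2IC" using T[of "CImp ?b (COr ?a ?b)"] by simp
  show "(a \<^bold>\<or> b) \<^bold>\<longrightarrow> (\<^bold>\<not> a) \<^bold>\<longrightarrow> b \<in> MS2IC"
    using T[of "CImp (COr ?a ?b) (CImp (CNeg ?a) ?b)"] by simp
  show "(a \<^bold>\<longleftrightarrow> b) \<^bold>\<longrightarrow> a \<^bold>\<longrightarrow> b \<in> MS2IC" using T[of "CImp (CIff ?a ?b) (CImp ?a ?b)"] by simp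
  show "(a \<^bold>\<longleftrightarrow> b) \<^bold>\<longrightarrow> b \<^bold>\<longrightarrow> a \<in> MS2IC" using T[of "CImp (CIff ?a ?b) (CImp ?b ?a)"] by simp
  show "(a \<^bold>\<longrightarrow> b) \<^bold>\<longrightarrow> (b \<^bold>\<longrightarrow> a) \<^bold>\<longrightarrow> (a \<^bold>\<longleftrightarrow> b) \<in> MS2IC"
    using T[of "CImp (CImp ?a ?b) (CImp (CImp ?b ?a) (CIff ?a ?b))"] by auto
qed

text \<open>Modus ponens is the only rule applied to hypotheses; both necessitations stay confined
  to theorems, which is what makes the deduction theorem hold.\<close>

inductive derives :: "fm set \<Rightarrow> fm \<Rightarrow> bool" (infix "\<turnstile>" 50) for \<Gamma> where
  hyp: "a \<in> \<Gamma> \<Longrightarrow> \<Gamma> \<turnstile> a"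
| ax: "a \<in> MS2IC \<Longrightarrow> \<Gamma> \<turnstile> a"
| mp: "\<Gamma> \<turnstile> a \<^bold>\<longrightarrow> b \<Longrightarrow> \<Gamma> \<turnstile> a \<Longrightarrow> \<Gamma> \<turnstile> b"

lemma derives_mono: "\<Gamma> \<turnstile> a \<Longrightarrow> \<Gamma> \<subseteq> \<Delta> \<Longrightarrow> \<Delta> \<turnstile> a"
  by (induction rule: derives.induct) (auto intro: derives.intros)

lemma derives_empty: "{} \<turnstile> a \<Longrightarrow> a \<in> MS2IC"
  by (induction rule: derives.induct) (auto intro: MP)

lemma deduction:
  assumes "insert a \<Gamma> \<turnstile> b"
  shows "\<Gamma> \<turnstile> a \<^bold>\<longrightarrow> b"
  using assms
proof (induction rule: derives.induct)
  case (hyp b)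
  then show ?case
    by (metis MS2IC_Imp_const MS2IC_Imp_refl derives.simps insertE)
next
  case (ax b)
  then show ?case
    by (metis MS2IC_Imp_const derives.simps)
next
  case (mp b c)
  then show ?case
    by (metis MS2IC_Imp_distrib derives.mp derives.ax)
qed

text \<open>Compactness without counting hypotheses: the two premises of a modus ponens come from
  two members of the chain, and the larger one derives both.\<close>

lemma derives_Union_chain:
  assumes "\<Union>C \<turnstile> a" "subset.chain A C" "C \<noteq> {}"
  shows "\<exists>\<Gamma>\<in>C. \<Gamma> \<turnstile> a"
  using assms(1)
proof (induction rule: derives.induct)
  case (mp a b)
  then obtain \<Gamma> \<Delta> where *: "\<Gamma> \<in> C" "\<Gamma> \<turnstile> a \<^bold>\<longrightarrow> b" "\<Delta> \<in> C" "\<Delta> \<turnstile> a" by blast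
  then have "\<Gamma> \<subseteq> \<Delta> \<or> \<Delta> \<subseteq> \<Gamma>" using assms(2) by (auto simp: subset_chain_def)
  then show ?case using * by (meson derives.mp derives_mono)
qed (use assms(3) in \<open>auto intro: derives.intros\<close>)

text \<open>The equivalence for negation packs consistency (left to right) and maximality (right to
  left) into one condition.\<close>

definition mcs :: "fm set \<Rightarrow> bool" where
  "mcs w \<longleftrightarrow> (\<forall>a. w \<turnstile> a \<longrightarrow> a \<in> w) \<and> (\<forall>a. \<^bold>\<not> a \<in> w \<longleftrightarrow> a \<notin> w)"

lemma lindenbaum:
  assumes "\<not> \<Gamma> \<turnstile> \<^bold>\<bottom>"
  shows "\<exists>w. mcs w \<and> \<Gamma> \<subseteq> w"
proof -
  let ?A = "{\<Delta>. \<Gamma> \<subseteq> \<Delta> \<and> \<not> \<Delta> \<turnstile> \<^bold>\<bottom>}"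
  have "\<exists>w\<in>?A. \<forall>\<Delta>\<in>?A. w \<subseteq> \<Delta> \<longrightarrow> \<Delta> = w"
  proof (rule subset_Zorn_nonempty)
    show "?A \<noteq> {}" using assms by blast
  next
    fix C assume C: "C \<noteq> {}" "subset.chain ?A C"
    then have "C \<subseteq> ?A" by (simp add: subset_chain_def)
    then have "\<not> \<Union>C \<turnstile> \<^bold>\<bottom>" using derives_Union_chain[OF _ C(2,1)] by blast
    then show "\<Union>C \<in> ?A" using C(1) \<open>C \<subseteq> ?A\<close> by blast
  qed
  then obtain w where w: "\<Gamma> \<subseteq> w" "\<not> w \<turnstile> \<^bold>\<bottom>"
    and max: "\<And>\<Delta>. w \<subseteq> \<Delta> \<Longrightarrow> \<not> \<Delta> \<turnstile> \<^bold>\<bottom> \<Longrightarrow> \<Delta> = w" by auto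
  have not_mem: "w \<turnstile> a \<^bold>\<longrightarrow> \<^bold>\<bottom>" if "a \<notin> w" for a
    using max[of "insert a w"] that deduction by blast
  have closed: "a \<in> w" if "w \<turnstile> a" for a
    using not_mem that w(2) derives.mp by blast
  have "\<^bold>\<not> a \<in> w \<longleftrightarrow> a \<notin> w" for a
  proof
    assume "\<^bold>\<not> a \<in> w"
    then have "w \<turnstile> a \<^bold>\<longrightarrow> \<^bold>\<bottom>" by (meson MS2IC_Neg_Imp derives.intros)
    then show "a \<notin> w" using w(2) by (meson derives.intros)
  next
    assume "a \<notin> w"
    then show "\<^bold>\<not> a \<in> w" using not_mem by (meson MS2IC_Imp_Bot closed derives.intros)
  qed
  then show ?thesis using closed w(1) by (auto simp: mcs_def)
qed

section \<open>Membership of compound formulas in maximal consistent sets\<close>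

lemma mcs_thm: "mcs w \<Longrightarrow> a \<in> MS2IC \<Longrightarrow> a \<in> w"
  by (simp add: mcs_def derives.ax)

lemma mcs_mp: "mcs w \<Longrightarrow> a \<^bold>\<longrightarrow> b \<in> w \<Longrightarrow> a \<in> w \<Longrightarrow> b \<in> w"
  by (meson mcs_def derives.intros)

lemma mcs_thm_mp: "mcs w \<Longrightarrow> a \<^bold>\<longrightarrow> b \<in> MS2IC \<Longrightarrow> a \<in> w \<Longrightarrow> b \<in> w"
  by (meson mcs_mp mcs_thm)

lemma mcs_Neg: "mcs w \<Longrightarrow> \<^bold>\<not> a \<in> w \<longleftrightarrow> a \<notin> w"
  by (simp add: mcs_def)

lemma mcs_Top: "mcs w \<Longrightarrow> \<^bold>\<top> \<in> w"
  by (simp add: mcs_thm MS2IC_Top)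

lemma mcs_Bot: "mcs w \<Longrightarrow> \<^bold>\<bottom> \<notin> w"
  using mcs_Neg mcs_thm MS2IC_not_Bot by blast

lemma mcs_Imp: "mcs w \<Longrightarrow> a \<^bold>\<longrightarrow> b \<in> w \<longleftrightarrow> (a \<in> w \<longrightarrow> b \<in> w)"
  by (meson MS2IC_Imp_const MS2IC_Neg_Imp mcs_Neg mcs_mp mcs_thm)

lemma mcs_And: "mcs w \<Longrightarrow> a \<^bold>\<and> b \<in> w \<longleftrightarrow> a \<in> w \<and> b \<in> w"
  by (meson MS2IC_And1 MS2IC_And2 MS2IC_AndI mcs_mp mcs_thm)

lemma mcs_Or: "mcs w \<Longrightarrow> a \<^bold>\<or> b \<in> w \<longleftrightarrow> a \<in> w \<or> b \<in> w"
  by (meson MS2IC_Or1 MS2IC_Or2 MS2IC_OrE mcs_Neg mcs_mp mcs_thm)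

lemma mcs_Iff: "mcs w \<Longrightarrow> a \<^bold>\<longleftrightarrow> b \<in> w \<longleftrightarrow> (a \<in> w \<longleftrightarrow> b \<in> w)"
  by (meson MS2IC_Iff1 MS2IC_Iff2 MS2IC_IffI mcs_Imp mcs_mp mcs_thm)

lemmas mcs_simps = mcs_Neg mcs_Top mcs_Bot mcs_Imp mcs_And mcs_Or mcs_Iff

lemma mcs_Strict_Bot: "mcs w \<Longrightarrow> \<^bold>\<bottom> \<^bold>\<leadsto> b \<in> w"
  using mcs_thm[OF _ A1] mcs_And by blast

lemma mcs_Strict_Top: "mcs w \<Longrightarrow> a \<^bold>\<leadsto> \<^bold>\<top> \<in> w"
  using mcs_thm[OF _ A1] mcs_And by blast

lemma mcs_Strict_Or: "mcs w \<Longrightarrow> (a \<^bold>\<or> b) \<^bold>\<leadsto> c \<in> w \<longleftrightarrow> a \<^bold>\<leadsto> c \<in> w \<and> b \<^bold>\<leadsto> c \<in> w"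
  using mcs_thm[OF _ A2] mcs_And mcs_Iff by blast

lemma mcs_Strict_And: "mcs w \<Longrightarrow> a \<^bold>\<leadsto> (b \<^bold>\<and> c) \<in> w \<longleftrightarrow> a \<^bold>\<leadsto> b \<in> w \<and> a \<^bold>\<leadsto> c \<in> w"
  using mcs_thm[OF _ A3] mcs_And mcs_Iff by blast

lemma mcs_Strict_Neg: "mcs w \<Longrightarrow> (\<^bold>\<not> b) \<^bold>\<leadsto> (\<^bold>\<not> a) \<in> w \<longleftrightarrow> a \<^bold>\<leadsto> b \<in> w"
  using mcs_thm[OF _ A5] mcs_Iff by blast

lemma mcs_All_Strict: "mcs w \<Longrightarrow> \<^bold>\<top> \<^bold>\<leadsto> (a \<^bold>\<leadsto> b) \<in> w \<longleftrightarrow> a \<^bold>\<leadsto> b \<in> w"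
  using mcs_thm[OF _ A10] mcs_Iff by blast

text \<open>(Add) turns \<top> \<leadsto> \<open>a\<close> into \<box>\<top> \<leadsto>
  \<box>\<open>a\<close>, (A4) weakens this to a material implication, and \<box>\<top> is a
  theorem.\<close>

lemma mcs_All_Box:
  assumes "mcs w" "\<^bold>\<top> \<^bold>\<leadsto> a \<in> w"
  shows "\<^bold>\<box> a \<in> w"
proof -
  have "(\<^bold>\<box> \<^bold>\<top>) \<^bold>\<leadsto> (\<^bold>\<box> a) \<in> w" using assms Add mcs_thm_mp by blast
  then have "(\<^bold>\<box> \<^bold>\<top>) \<^bold>\<longrightarrow> (\<^bold>\<box> a) \<in> w" using assms A4 mcs_thm_mp by blast
  then show ?thesis using assms(1) mcs_mp mcs_thm Nec_Box MS2IC_Top by blast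
qed

section \<open>The canonical model\<close>

definition box_succ :: "fm set \<Rightarrow> fm set \<Rightarrow> bool" where
  "box_succ w u \<longleftrightarrow> mcs u \<and> (\<forall>a. \<^bold>\<box> a \<in> w \<longrightarrow> a \<in> u)"

lemma derives_Box:
  assumes "mcs w" "{a. \<^bold>\<box> a \<in> w} \<turnstile> b"
  shows "\<^bold>\<box> b \<in> w"
  using assms(2)
proof (induction rule: derives.induct)
  case (mp a b)
  then show ?case using mcs_thm_mp[OF assms(1) K] mcs_mp[OF assms(1)] by blast
qed (use assms(1) in \<open>auto intro: mcs_thm Nec_Box\<close>)

lemma mcs_Box:
  assumes "mcs w"
  shows "\<^bold>\<box> a \<in> w \<longleftrightarrow> (\<forall>u. box_succ w u \<longrightarrow> a \<in> u)"
proof (intro iffI)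
  assume R: "\<forall>u. box_succ w u \<longrightarrow> a \<in> u"
  show "\<^bold>\<box> a \<in> w"
  proof (rule ccontr)
    assume "\<^bold>\<box> a \<notin> w"
    then have "\<not> {b. \<^bold>\<box> b \<in> w} \<turnstile> a" using derives_Box assms by blast
    \<comment> \<open>This is the existence argument for a successor that refutes \<open>a\<close>:
      an inconsistency would yield a derivation of \<open>a\<close> from the boxed formulas.\<close>
    then have "\<not> insert (\<^bold>\<not> a) {b. \<^bold>\<box> b \<in> w} \<turnstile> \<^bold>\<bottom>"
      using deduction MS2IC_classical by (meson derives.intros)
    then obtain u where "mcs u" "insert (\<^bold>\<not> a) {b. \<^bold>\<box> b \<in> w} \<subseteq> u"
      using lindenbaum by blast
    then have "box_succ w u" "a \<notin> u" by (auto simp: box_succ_def mcs_Neg)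
    then show False using R by blast
  qed
qed (simp add: box_succ_def)

definition cluster :: "fm set \<Rightarrow> fm set set" where
  "cluster w = {u. mcs u \<and> (\<forall>a b. a \<^bold>\<leadsto> b \<in> u \<longleftrightarrow> a \<^bold>\<leadsto> b \<in> w)}"

lemma cluster_mcs: "u \<in> cluster w \<Longrightarrow> mcs u"
  by (simp add: cluster_def)

lemma cluster_Strict: "u \<in> cluster w \<Longrightarrow> a \<^bold>\<leadsto> b \<in> u \<longleftrightarrow> a \<^bold>\<leadsto> b \<in> w"
  by (simp add: cluster_def)

lemma cluster_self: "mcs w \<Longrightarrow> w \<in> cluster w"
  by (simp add: cluster_def)

text \<open>By (A10) a strict formula in \<open>u\<close> is universally necessary there, and by
  (A9) so is the negation of one missing from \<open>u\<close>. Universal necessity implies \<box>,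
  so both facts pass to \<open>v\<close>.\<close>

lemma cluster_box_succ:
  assumes "u \<in> cluster w" "box_succ u v"
  shows "v \<in> cluster w"
proof -
  have u: "mcs u" and v: "mcs v" using assms by (auto simp: cluster_def box_succ_def)
  have "a \<^bold>\<leadsto> b \<in> v \<longleftrightarrow> a \<^bold>\<leadsto> b \<in> u" for a b
  proof
    assume "a \<^bold>\<leadsto> b \<in> u"
    then have "\<^bold>\<box> (a \<^bold>\<leadsto> b) \<in> u" using u mcs_All_Strict mcs_All_Box by blast
    then show "a \<^bold>\<leadsto> b \<in> v" using assms(2) by (simp add: box_succ_def)
  next
    assume R: "a \<^bold>\<leadsto> b \<in> v"
    show "a \<^bold>\<leadsto> b \<in> u"
    proof (rule ccontr)
      assume "a \<^bold>\<leadsto> b \<notin> u"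
      then have "\<^bold>\<not> (\<^bold>\<top> \<^bold>\<leadsto> (a \<^bold>\<leadsto> b)) \<in> u" using u by (simp add: mcs_Neg mcs_All_Strict)
      then have "\<^bold>\<box> (\<^bold>\<not> (\<^bold>\<top> \<^bold>\<leadsto> (a \<^bold>\<leadsto> b))) \<in> u" using u A9 mcs_thm_mp mcs_All_Box by blast
      then have "\<^bold>\<not> (\<^bold>\<top> \<^bold>\<leadsto> (a \<^bold>\<leadsto> b)) \<in> v" using assms(2) by (simp add: box_succ_def)
      then show False using R v by (simp add: mcs_Neg mcs_All_Strict)
    qed
  qed
  then show ?thesis using assms(1) v by (simp add: cluster_def)
qed

section \<open>Reinterpreting strict implication\<close>

text \<open>Least set of pairs that must be refused: the failures in \<open>w\<close> without
  \<open>p\<close>, closed under passing from a failing component to the compound pair in (A2), (A3)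
  and (A5). Every other pair is accepted by default, which favours pairs containing
  \<open>p\<close>.\<close>

inductive rejected :: "fm set \<Rightarrow> nat \<Rightarrow> fm \<Rightarrow> fm \<Rightarrow> bool" for w p where
  base: "p \<notin> vars a \<Longrightarrow> p \<notin> vars b \<Longrightarrow> a \<^bold>\<leadsto> b \<notin> w \<Longrightarrow> rejected w p a b"
| or1: "rejected w p a c \<Longrightarrow> rejected w p (a \<^bold>\<or> b) c"
| or2: "rejected w p b c \<Longrightarrow> rejected w p (a \<^bold>\<or> b) c"
| and1: "rejected w p a b \<Longrightarrow> rejected w p a (b \<^bold>\<and> c)"
| and2: "rejected w p a c \<Longrightarrow> rejected w p a (b \<^bold>\<and> c)"
| neg: "rejected w p a b \<Longrightarrow> rejected w p (\<^bold>\<not> b) (\<^bold>\<not> a)"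

text \<open>On pairs without \<open>p\<close> the closure rules add nothing, because
  \<open>w\<close> itself obeys (A2), (A3) and (A5).\<close>

lemma rejected_fresh:
  assumes "mcs w" "rejected w p a b" "p \<notin> vars a" "p \<notin> vars b"
  shows "a \<^bold>\<leadsto> b \<notin> w"
  using assms(2-)
  by (induction rule: rejected.induct)
    (auto simp: mcs_Strict_Or mcs_Strict_And mcs_Strict_Neg assms(1))

text \<open>In the base case (A2) in \<open>w\<close> passes the failure to a disjunct. The last
  rule may instead have split a conjunction \<open>c\<close>, so induction is needed, not just a
  case distinction.\<close>

lemma rejected_Or:
  assumes "mcs w"
  shows "rejected w p (a \<^bold>\<or> b) c \<longleftrightarrow> rejected w p a c \<or> rejected w p b c"
proof
  show "rejected w p (a \<^bold>\<or> b) c \<Longrightarrow> rejected w p a c \<or> rejected w p b c"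
    by (induction "a \<^bold>\<or> b" c rule: rejected.induct)
      (auto simp: mcs_Strict_Or assms intro: rejected.intros)
qed (auto intro: rejected.intros)

lemma rejected_And:
  assumes "mcs w"
  shows "rejected w p a (b \<^bold>\<and> c) \<longleftrightarrow> rejected w p a b \<or> rejected w p a c"
proof
  show "rejected w p a (b \<^bold>\<and> c) \<Longrightarrow> rejected w p a b \<or> rejected w p a c"
    by (induction a "b \<^bold>\<and> c" rule: rejected.induct)
      (auto simp: mcs_Strict_And assms intro: rejected.intros)
qed (auto intro: rejected.intros)

lemma rejected_Neg:
  assumes "mcs w"
  shows "rejected w p (\<^bold>\<not> b) (\<^bold>\<not> a) \<longleftrightarrow> rejected w p a b"
proof
  show "rejected w p (\<^bold>\<not> b) (\<^bold>\<not> a) \<Longrightarrow> rejected w p a b"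
    by (erule rejected.cases) (auto simp: mcs_Strict_Neg assms intro: rejected.base)
qed (rule rejected.neg)

section \<open>Pairs that are never rejected\<close>

lemma not_rejected_Bot:
  assumes "mcs w"
  shows "\<not> rejected w p \<^bold>\<bottom> b"
proof
  show "rejected w p \<^bold>\<bottom> b \<Longrightarrow> False"
    by (induction "\<^bold>\<bottom>" b rule: rejected.induct) (auto simp: mcs_Strict_Bot assms)
qed

lemma not_rejected_Top:
  assumes "mcs w"
  shows "\<not> rejected w p a \<^bold>\<top>"
proof
  show "rejected w p a \<^bold>\<top> \<Longrightarrow> False"
    by (induction a "\<^bold>\<top>" rule: rejected.induct) (auto simp: mcs_Strict_Top assms)
qed

text \<open>With \<top> on the left only the base rule and the conjunction rules apply; conjuncts of
  theorems are theorems, and necessitation rules out the base case.\<close>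

lemma not_rejected_theorem:
  assumes "mcs w" "b \<in> MS2IC"
  shows "\<not> rejected w p \<^bold>\<top> b"
proof
  assume "rejected w p \<^bold>\<top> b"
  then show False
    using assms(2)
    by (induction "\<^bold>\<top>" b rule: rejected.induct)
      (use assms(1) in \<open>auto intro: mcs_thm Nec_All MP MS2IC_And1 MS2IC_And2\<close>)
qed

text \<open>The base rule needs \<open>p\<close> to be absent, and the only other applicable rules
  split a disjunction on the left, keeping \<open>Var p\<close> on the right.\<close>

lemma not_rejected_Var_right: "\<not> rejected w p a (Var p)"
proof
  show "rejected w p a (Var p) \<Longrightarrow> False"
    by (induction a "Var p" rule: rejected.induct) auto
qed

lemma not_rejected_Var_left: "\<not> rejected w p (Var p) b"
proof
  show "rejected w p (Var p) b \<Longrightarrow> False"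
    by (induction "Var p" b rule: rejected.induct) auto
qed

text \<open>For these four shapes only the base rule fits, so a rejected pair is free of
  \<open>p\<close> and its strict formula is missing from \<open>w\<close>.\<close>

inductive_cases rejected_Top_StrictE: "rejected w p \<^bold>\<top> (a \<^bold>\<leadsto> b)"
inductive_cases rejected_Top_NegE: "rejected w p \<^bold>\<top> (\<^bold>\<not> a)"
inductive_cases rejected_Neg_BotE: "rejected w p (\<^bold>\<not> a) \<^bold>\<bottom>"
inductive_cases rejected_BoxE: "rejected w p (\<^bold>\<box> a) (\<^bold>\<box> b)"

text \<open>The strict clause does not depend on \<open>u\<close>, so the condition on worlds in
  (A8) to (A11) is immediate and only rejection remains to be checked.\<close>

primrec sat :: "fm set \<Rightarrow> nat \<Rightarrow> fm \<Rightarrow> fm set \<Rightarrow> fm \<Rightarrow> bool" where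
  "sat w p \<phi> u (Var n) \<longleftrightarrow> (if n = p then \<phi> \<in> u else Var n \<in> u)"
| "sat w p \<phi> u \<^bold>\<top> \<longleftrightarrow> True"
| "sat w p \<phi> u \<^bold>\<bottom> \<longleftrightarrow> False"
| "sat w p \<phi> u (\<^bold>\<not> a) \<longleftrightarrow> \<not> sat w p \<phi> u a"
| "sat w p \<phi> u (a \<^bold>\<and> b) \<longleftrightarrow> sat w p \<phi> u a \<and> sat w p \<phi> u b"
| "sat w p \<phi> u (a \<^bold>\<or> b) \<longleftrightarrow> sat w p \<phi> u a \<or> sat w p \<phi> u b"
| "sat w p \<phi> u (a \<^bold>\<longrightarrow> b) \<longleftrightarrow> (sat w p \<phi> u a \<longrightarrow> sat w p \<phi> u b)"
| "sat w p \<phi> u (a \<^bold>\<longleftrightarrow> b) \<longleftrightarrow> (sat w p \<phi> u a \<longleftrightarrow> sat w p \<phi> u b)"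
| "sat w p \<phi> u (a \<^bold>\<leadsto> b) \<longleftrightarrow>
    (\<forall>v\<in>cluster w. sat w p \<phi> v a \<longrightarrow> sat w p \<phi> v b) \<and> \<not> rejected w p a b"
| "sat w p \<phi> u (\<^bold>\<box> a) \<longleftrightarrow> (\<forall>v. box_succ u v \<longrightarrow> sat w p \<phi> v a)"

lemma sat_inst: "sat w p \<phi> u (inst s a) \<longleftrightarrow> ceval (\<lambda>n. sat w p \<phi> u (s n)) a"
  by (induction a) auto

lemma sat_fresh:
  assumes "mcs w" "p \<notin> vars a" "u \<in> cluster w"
  shows "sat w p \<phi> u a \<longleftrightarrow> a \<in> u"
  using assms(2,3)
proof (induction a arbitrary: u)
  case (Strict a b)
  have "sat w p \<phi> u (a \<^bold>\<leadsto> b) \<longleftrightarrow> (\<forall>v\<in>cluster w. a \<in> v \<longrightarrow> b \<in> v) \<and> a \<^bold>\<leadsto> b \<in> w"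
    using Strict rejected_fresh[OF assms(1)] by (auto intro: rejected.base)
  \<comment> \<open>Membership in \<open>w\<close> already forces the condition on worlds, by (A4)
    at each world of the cluster. The converse may fail, which is why rejection is recorded
    separately.\<close>
  also have "\<dots> \<longleftrightarrow> a \<^bold>\<leadsto> b \<in> w"
    using mcs_thm_mp[OF _ A4] mcs_mp cluster_mcs cluster_Strict by blast
  finally show ?case using Strict.prems cluster_Strict by blast
next
  case (Box a)
  then show ?case using mcs_Box cluster_mcs cluster_box_succ by simp
qed (auto simp: cluster_mcs mcs_simps)

theorem soundness:
  assumes w: "mcs w" and "a \<in> MS2IC" "u \<in> cluster w"
  shows "sat w p \<phi> u a"
  using assms(2,3)
proof (induction arbitrary: u rule: MS2IC.induct)
  case (Taut a s)
  then show ?case by (simp add: sat_inst tautology_def)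
next
  case (A8 a)
  \<comment> \<open>A rejected conclusion is free of \<open>p\<close> and fails in \<open>w\<close>;
    by the axiom in \<open>w\<close> the premise fails there too and is itself rejected. (A10),
    (A11) and (Add) follow the same pattern.\<close>
  then show ?case using mcs_thm_mp[OF w MS2IC.A8]
    by (auto elim!: rejected_Top_StrictE intro: rejected.base simp: MS2IC_Top)
next
  case (A9 a)
  \<comment> \<open>Here the premise is negative and may hold because of some world instead of a
    rejection, so the contradiction goes through \<open>sat_fresh\<close>.\<close>
  have "\<not> rejected w p \<^bold>\<top> (\<^bold>\<not> (\<^bold>\<top> \<^bold>\<leadsto> a))" if "\<not> sat w p \<phi> u (\<^bold>\<top> \<^bold>\<leadsto> a)"
  proof
    assume "rejected w p \<^bold>\<top> (\<^bold>\<not> (\<^bold>\<top> \<^bold>\<leadsto> a))"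
    then have "p \<notin> vars (\<^bold>\<top> \<^bold>\<leadsto> a)" "\<^bold>\<top> \<^bold>\<leadsto> (\<^bold>\<not> (\<^bold>\<top> \<^bold>\<leadsto> a)) \<notin> w"
      by (auto elim: rejected_Top_NegE)
    moreover from this have "\<^bold>\<top> \<^bold>\<leadsto> a \<in> w"
      using mcs_thm_mp[OF w MS2IC.A9] mcs_Neg[OF w] by blast
    ultimately show False using that sat_fresh[OF w] cluster_Strict A9 by blast
  qed
  then show ?case by auto
next
  case (A10 a b)
  then show ?case using mcs_All_Strict[OF w]
    by (auto elim!: rejected_Top_StrictE intro: rejected.base)
next
  case (A11 a)
  then show ?case using mcs_thm_mp[OF w MS2IC.A11]
    by (auto elim!: rejected_Neg_BotE intro: rejected.base)
next
  case (Add a b)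
  then show ?case using mcs_thm_mp[OF w MS2IC.Add] cluster_box_succ
    by (auto elim!: rejected_BoxE intro: rejected.base)
next
  case (Nec_All a)
  then show ?case using not_rejected_theorem[OF w] by simp
next
  case (Nec_Box a)
  then show ?case using cluster_box_succ by simp
qed (auto simp: w rejected_Or rejected_And rejected_Neg not_rejected_Bot not_rejected_Top)

theorem theorem4p16:
  fixes \<phi> \<psi> \<chi> :: fm and p :: nat
  assumes "p \<notin> vars \<phi>" and "p \<notin> vars \<psi>" and "p \<notin> vars \<chi>"
    and "((\<phi> \<^bold>\<leadsto> Var p) \<^bold>\<and> (Var p \<^bold>\<leadsto> \<psi>) \<^bold>\<and> (Var p \<^bold>\<leadsto> Var p)) \<^bold>\<longrightarrow> \<chi> \<in> MS2IC"
  shows "(\<phi> \<^bold>\<leadsto> \<psi>) \<^bold>\<longrightarrow> \<chi> \<in> MS2IC"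
proof (rule ccontr)
  let ?\<theta> = "(\<phi> \<^bold>\<leadsto> \<psi>) \<^bold>\<longrightarrow> \<chi>"
  assume "?\<theta> \<notin> MS2IC"
  then have "\<not> {\<^bold>\<not> ?\<theta>} \<turnstile> \<^bold>\<bottom>"
    using deduction derives_empty MP MS2IC_classical by blast
  then obtain w where w: "mcs w" and "\<^bold>\<not> ?\<theta> \<in> w" using lindenbaum by blast
  then have strict: "\<phi> \<^bold>\<leadsto> \<psi> \<in> w" and "\<chi> \<notin> w" by (auto simp: mcs_simps)
  \<comment> \<open>Since \<open>p\<close> is true exactly where \<phi> is, this is the condition on
    worlds for \<open>p\<close> \<leadsto> \<psi>; for the other two conjuncts it is
    trivial.\<close>
  have "\<psi> \<in> u" if "u \<in> cluster w" "\<phi> \<in> u" for u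
    using that strict mcs_thm_mp[OF _ A4] mcs_mp cluster_mcs cluster_Strict by blast
  then have "sat w p \<phi> w ((\<phi> \<^bold>\<leadsto> Var p) \<^bold>\<and> (Var p \<^bold>\<leadsto> \<psi>) \<^bold>\<and> (Var p \<^bold>\<leadsto> Var p))"
    using assms(1,2) by (simp add: sat_fresh w not_rejected_Var_left not_rejected_Var_right)
  then have "sat w p \<phi> w \<chi>" using soundness[OF w assms(4) cluster_self[OF w]] by simp
  then show False using \<open>\<chi> \<notin> w\<close> sat_fresh[OF w assms(3) cluster_self[OF w]] by blast
qed

end
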